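(* Let $X$ be an Archimedean vector lattice with ru-completion $X^r$. Every positive semigroup $(T_s)_{s\ge 0}$ on $X$ has a unique extension to a positive semigroup $(T_s^r)_{s\ge 0}$ on $X^r$; that is, there exists exactly one positive semigroup $(T_s^r)_{s\ge 0}$ on $X^r$ such that $T_s^r x=T_sx$ for all $x\in X$ and $s\ge 0$.
   Context: All vector spaces are real and all operators are linear. A semigroup on a vector space $V$ is a family $(T_s)_{s\ge 0}$ of linear operators $V\to V$ such that $T_{s+t}=T_sT_t$ for all $s,t\in\mathbb{R}_+$ and $T_0=I_V$ (no continuity in $s$ is assumed). A semigroup on a vector lattice is positive if every $T_s$ is a positive operator. Let $Y$ be an Archimedean vector lattice. A net $(x_\alpha)$ in $Y$ ru-converges to $x\in Y$ with regulator $u\in Y$, written $x_\alpha\xrightarrow{(ru)}x(u)$, if for every $k\in\mathbb{N}$ there is $\alpha_k$ with $|x_\alpha-x|\le\frac1k|u|$ for all $\alpha\ge\alpha_k$. A net $(x_\alpha)$ is ru-Cauchy with regulator $u$ if for every $k\in\mathbb{N}$ there is $\alpha_k$ with $|x_\alpha-x_{\alpha'}|\le\frac1k|u|$ for all $\alpha,\alpha'\ge\alpha_k$. An Archimedean vector lattice $Y$ is ru-complete in itself if for every ru-Cauchy net $(x_\alpha)$ in $Y$ with a regulator $u\in Y$ there exist $x\in Y$ and $w\in Y$ with $x_\alpha\xrightarrow{(ru)}x(w)$ (it is equivalent to require this for sequences only). An ru-completion of $X$ is a vector lattice $F$, ru-complete in itself, for which there exists a lattice embedding $J:X\to F$ such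 that for each ru-complete in itself vector lattice $Y$ and each lattice homomorphism $T:X\to Y$ there exists a unique lattice homomorphism $S:F\to Y$ with $S\circ J=T$. The ru-completion exists and is unique up to lattice isomorphism; it is denoted $X^r$, and $X$ is identified with the sublattice $J(X)$ of $X^r$. Concretely, $X^r$ can be realized as the intersection of all vector sublattices of the order (Dedekind) completion $X^\delta$ that contain $X$ and are ru-complete in themselves. *)

theory Defs
  imports Complex_Main "HOL-Algebra.Group"
begin

text \<open>
  The universal property of the ru-completion quantifies over vector lattices, which is not
  possible for type classes. Hence vector lattices also appear as structures on a carrier set.
\<close>

record 'v vlat = "'v gorder" +
  vadd :: "'v \<Rightarrow> 'v \<Rightarrow> 'v"
  vzero :: "'v"
  vscale :: "real \<Rightarrow> 'v \<Rightarrow> 'v"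

locale vector_lattice = lattice V for V :: "'v vlat" (structure) +
  assumes add_group: "comm_group \<lparr>carrier = carrier V, mult = vadd V, one = vzero V\<rparr>"
    and scale_closed: "x \<in> carrier V \<Longrightarrow> vscale V a x \<in> carrier V"
    and scale_add_right: "x \<in> carrier V \<Longrightarrow> y \<in> carrier V \<Longrightarrow>
          vscale V a (vadd V x y) = vadd V (vscale V a x) (vscale V a y)"
    and scale_add_left: "x \<in> carrier V \<Longrightarrow>
          vscale V (a + b) x = vadd V (vscale V a x) (vscale V b x)"
    and scale_scale: "x \<in> carrier V \<Longrightarrow> vscale V a (vscale V b x) = vscale V (a * b) x"
    and scale_one: "x \<in> carrier V \<Longrightarrow> vscale V 1 x = x"
    and add_mono: "x \<in> carrier V \<Longrightarrow> y \<in> carrier V \<Longrightarrow> z \<in> carrier V \<Longrightarrow>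
          x \<sqsubseteq> y \<Longrightarrow> vadd V x z \<sqsubseteq> vadd V y z"
    and scale_mono: "x \<in> carrier V \<Longrightarrow> y \<in> carrier V \<Longrightarrow> 0 \<le> a \<Longrightarrow>
          x \<sqsubseteq> y \<Longrightarrow> vscale V a x \<sqsubseteq> vscale V a y"

definition vdiff :: "'v vlat \<Rightarrow> 'v \<Rightarrow> 'v \<Rightarrow> 'v"
  where "vdiff V x y = vadd V x (vscale V (- 1) y)"

definition vabs :: "'v vlat \<Rightarrow> 'v \<Rightarrow> 'v"
  where "vabs V x = x \<squnion>\<^bsub>V\<^esub> vscale V (- 1) x"

definition archimedean :: "'v vlat \<Rightarrow> bool"
  where "archimedean V \<longleftrightarrow>
    (\<forall>x\<in>carrier V. \<forall>y\<in>carrier V.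
       vzero V \<sqsubseteq>\<^bsub>V\<^esub> x \<and> (\<forall>n::nat. vscale V (real n) x \<sqsubseteq>\<^bsub>V\<^esub> y) \<longrightarrow> x = vzero V)"

definition ru_converges :: "'v vlat \<Rightarrow> (nat \<Rightarrow> 'v) \<Rightarrow> 'v \<Rightarrow> 'v \<Rightarrow> bool"
  where "ru_converges V f x u \<longleftrightarrow>
    (\<forall>k::nat. k > 0 \<longrightarrow>
       (\<exists>N. \<forall>n\<ge>N. vabs V (vdiff V (f n) x) \<sqsubseteq>\<^bsub>V\<^esub> vscale V (1 / real k) (vabs V u)))"

definition ru_Cauchy :: "'v vlat \<Rightarrow> (nat \<Rightarrow> 'v) \<Rightarrow> 'v \<Rightarrow> bool"
  where "ru_Cauchy V f u \<longleftrightarrow>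
    (\<forall>k::nat. k > 0 \<longrightarrow>
       (\<exists>N. \<forall>m\<ge>N. \<forall>n\<ge>N.
          vabs V (vdiff V (f m) (f n)) \<sqsubseteq>\<^bsub>V\<^esub> vscale V (1 / real k) (vabs V u)))"

text \<open>
  Completeness for sequences is equivalent to completeness for nets: an ru-Cauchy net has an
  ru-Cauchy sequence \<open>x (\<alpha> k)\<close> with \<open>\<alpha>\<close> increasing, and an ru-limit of this sequence with
  regulator \<open>w\<close> is an ru-limit of the net with regulator \<open>\<bar>u\<bar> + \<bar>w\<bar>\<close>.
\<close>

definition ru_complete :: "'v vlat \<Rightarrow> bool"
  where "ru_complete V \<longleftrightarrow> archimedean V \<and>
    (\<forall>f u. (\<forall>n. f n \<in> carrier V) \<and> u \<in> carrier V \<and> ru_Cauchy V f u \<longrightarrow>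
       (\<exists>x\<in>carrier V. \<exists>w\<in>carrier V. ru_converges V f x w))"

definition vl_hom :: "'v vlat \<Rightarrow> 'w vlat \<Rightarrow> ('v \<Rightarrow> 'w) \<Rightarrow> bool"
  where "vl_hom V W T \<longleftrightarrow> T \<in> carrier V \<rightarrow> carrier W \<and>
    (\<forall>x\<in>carrier V. \<forall>y\<in>carrier V. T (vadd V x y) = vadd W (T x) (T y)) \<and>
    (\<forall>a. \<forall>x\<in>carrier V. T (vscale V a x) = vscale W a (T x)) \<and>
    join_pres V W T \<and> meet_pres V W T"

definition type_vlat :: "'v::{ordered_real_vector, lattice} vlat"
  where "type_vlat =
    \<lparr>carrier = UNIV, eq = (=), le = (\<le>), vadd = (+), vzero = 0, vscale = (*\<^sub>R)\<rparr>"

lemma type_vlat_simps [simp]: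
  "carrier type_vlat = UNIV"
  "x .=\<^bsub>type_vlat\<^esub> y \<longleftrightarrow> x = y"
  "x \<sqsubseteq>\<^bsub>type_vlat\<^esub> y \<longleftrightarrow> x \<le> y"
  "vadd type_vlat = (+)"
  "vzero type_vlat = 0"
  "vscale type_vlat = (*\<^sub>R)"
  by (simp_all add: type_vlat_def)

lemma least_Upper_type_vlat: "least type_vlat s (Upper type_vlat {x, y}) \<longleftrightarrow> s = Lattices.sup x y"
  by (auto simp: least_def Upper_def intro: order.antisym)

lemma greatest_Lower_type_vlat:
  "greatest type_vlat s (Lower type_vlat {x, y}) \<longleftrightarrow> s = Lattices.inf x y"
  by (auto simp: greatest_def Lower_def intro: order.antisym)

lemma join_type_vlat [simp]: "x \<squnion>\<^bsub>type_vlat\<^esub> y = Lattices.sup x y"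
  by (simp add: join_def Lattice.sup_def least_Upper_type_vlat)

lemma meet_type_vlat [simp]: "x \<sqinter>\<^bsub>type_vlat\<^esub> y = Lattices.inf x y"
  by (simp add: meet_def Lattice.inf_def greatest_Lower_type_vlat)

lemma vector_lattice_type_vlat:
  "vector_lattice (type_vlat :: 'v::{ordered_real_vector, lattice} vlat)"
proof -
  have "comm_group \<lparr>carrier = UNIV :: 'v set, mult = (+), one = 0\<rparr>"
    by (rule comm_groupI) (auto simp: add.assoc add.commute intro: exI [of _ "- _"])
  moreover have "Lattice.lattice (type_vlat :: 'v vlat)"
    by unfold_locales
      (auto simp: fun_eq_iff least_Upper_type_vlat greatest_Lower_type_vlat)
  ultimately show ?thesis
    by (intro vector_lattice.intro vector_lattice_axioms.intro)
      (auto simp: scaleR_add_right scaleR_add_left intro: scaleR_left_mono)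
qed

text \<open>
  \<open>J\<close> exhibits \<open>'f\<close> as an ru-completion of \<open>'a\<close>. The test lattices \<open>Y\<close> are all vector lattices
  carried by subsets of \<open>'f\<close>. This loses nothing: the ru-closure of \<open>range J\<close> in \<open>'f\<close> is an
  ru-completion of \<open>'a\<close>, and the universal property for it and for \<open>'f\<close> itself already forces
  the two to coincide, so that the universal property holds for \<open>Y\<close> over every type.
\<close>

definition ru_completion ::
    "('a::{ordered_real_vector, lattice} \<Rightarrow> 'f::{ordered_real_vector, lattice}) \<Rightarrow> bool"
  where "ru_completion J \<longleftrightarrow>
    ru_complete (type_vlat :: 'f vlat) \<and> vl_hom type_vlat type_vlat J \<and> inj J \<and>
    (\<forall>(Y :: 'f vlat) T. vector_lattice Y \<and> ru_complete Y \<and> vl_hom type_vlat Y T \<longrightarrow>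
       (\<exists>!S. vl_hom type_vlat Y S \<and> S \<circ> J = T))"

definition positive_operator ::
    "('v::{ordered_real_vector, lattice} \<Rightarrow> 'v) \<Rightarrow> bool"
  where "positive_operator T \<longleftrightarrow> linear T \<and> (\<forall>x\<ge>0. 0 \<le> T x)"

text \<open>The values \<open>T s\<close> for \<open>s < 0\<close> are irrelevant.\<close>

definition positive_semigroup ::
    "(real \<Rightarrow> 'v::{ordered_real_vector, lattice} \<Rightarrow> 'v) \<Rightarrow> bool"
  where "positive_semigroup T \<longleftrightarrow>
    (\<forall>s\<ge>0. positive_operator (T s)) \<and> T 0 = id \<and> (\<forall>s\<ge>0. \<forall>t\<ge>0. T (s + t) = T s \<circ> T t)"

end

theory Submission
  imports Defs
begin

text \<open>
  Everything reduces to one operator: if \<open>J : X \<rightarrow> F\<close> is an ru-completion, then every positive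
  operator \<open>P\<close> from \<open>X\<close> into an ru-complete vector lattice \<open>G\<close> factors through \<open>J\<close> by exactly one
  positive operator \<open>S : F \<rightarrow> G\<close> (\<open>positive_extension\<close>). For a semigroup this is applied with
  \<open>G = F\<close> to each \<open>J \<circ> T\<^sub>s\<close>; uniqueness turns \<open>T\<^sub>0 = I\<close> and \<open>T\<^sub>s\<^sub>+\<^sub>t = T\<^sub>s T\<^sub>t\<close> into the same laws for the
  extensions.

  The universal property of \<open>F\<close> only speaks of lattice homomorphisms, so it cannot be applied to \<open>P\<close>.
  It serves to show that \<open>F\<close> is as small as possible. Let \<open>C\<close> be the smallest subset of \<open>F\<close>
  that contains \<open>J X\<close> and all limits of its sequences that converge uniformly relative to a
  regulator in \<open>J X\<close>. The vector lattice operations are Lipschitz, so \<open>C\<close> is a vector sublattice; it is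
  majorized by \<open>J X\<close>, and hence ru-complete in itself. The universal property therefore gives a lattice
  homomorphism from \<open>F\<close> into \<open>C\<close> that fixes \<open>J X\<close>. As a map into \<open>F\<close> it can only be the identity, and
  so \<open>C = F\<close> (\<open>ru_hull_eq_UNIV\<close>). This is an induction principle for \<open>F\<close>, and it replaces a transfinite
  iteration of taking limits.

  Any positive extension \<open>S\<close> of \<open>P\<close> satisfies \<open>P a \<le> S y \<le> P b\<close> whenever \<open>J a \<le> y \<le> J b\<close>. Call \<open>y\<close>
  squeezed if the supremum of these lower bounds and the infimum of these upper bounds exist in \<open>G\<close> and
  agree. The elements of \<open>J X\<close> are squeezed. Limits of squeezed elements are squeezed as well: the
  values form a Cauchy sequence with regulator \<open>P u\<close> if the elements converge with regulator
  \<open>J u\<close>, and their limit is again squeezed (\<open>squeezed_value_exists_on_hull\<close>). By the induction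
  principle every \<open>y\<close> is squeezed, and its value is the only possible value \<open>S y\<close>. The map \<open>S\<close> is
  additive because the infima are subadditive and the suprema are superadditive.
\<close>

section \<open>Archimedean vector lattices and relatively uniform limits\<close>

text \<open>
  The relation \<open>\<bar>x - y\<bar> \<le> e\<close>, expressed by two inequalities because the lattice operations do not enter
  most of its uses.
\<close>

definition close_to :: "'v::ordered_ab_group_add \<Rightarrow> 'v \<Rightarrow> 'v \<Rightarrow> bool"
  where "close_to e x y \<longleftrightarrow> x - y \<le> e \<and> y - x \<le> e"

lemma close_toD: "close_to e x y \<Longrightarrow> x \<le> y + e" "close_to e x y \<Longrightarrow> y \<le> x + e"
  by (auto simp: close_to_def algebra_simps)

lemma close_to_sym: "close_to e x y \<Longrightarrow> close_to e y x"
  by (simp add: close_to_def)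

lemma close_to_weaken: "close_to d x y \<Longrightarrow> d \<le> e \<Longrightarrow> close_to e x y"
  by (auto simp: close_to_def intro: order.trans)

lemma close_to_trans:
  assumes "close_to d x y" and "close_to e y z"
  shows "close_to (d + e) x z"
proof -
  have "(x - y) + (y - z) \<le> d + e" "(z - y) + (y - x) \<le> e + d"
    using assms unfolding close_to_def by (blast intro: add_mono)+
  then show ?thesis
    by (simp add: close_to_def add.commute)
qed

lemma close_to_nonneg:
  fixes x y :: "'v::ordered_real_vector"
  assumes "close_to e x y"
  shows "0 \<le> e"
proof -
  have "(x - y) + (y - x) \<le> e + e"
    using assms by (intro add_mono) (auto simp: close_to_def)
  then have "0 \<le> 2 *\<^sub>R e"
    by (simp add: scaleR_2)
  then show ?thesis
    by (simp add: zero_le_scaleR_iff)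
qed

lemma close_to_minus: "close_to e x y \<Longrightarrow> close_to e (- x) (- y)"
  by (auto simp: close_to_def)

lemma close_to_scale: "close_to e x y \<Longrightarrow> close_to (\<bar>a\<bar> *\<^sub>R e) (a *\<^sub>R x) (a *\<^sub>R y)"
  for x y :: "'v::ordered_real_vector"
proof (cases "a \<ge> 0")
  case True
  moreover assume "close_to e x y"
  ultimately show ?thesis
    by (auto simp: close_to_def scaleR_diff_right [symmetric] intro: scaleR_left_mono)
next
  case False
  moreover assume "close_to e x y"
  ultimately have "(- a) *\<^sub>R (x - y) \<le> (- a) *\<^sub>R e" "(- a) *\<^sub>R (y - x) \<le> (- a) *\<^sub>R e"
    by (auto simp: close_to_def intro!: scaleR_left_mono simp del: scaleR_minus_left)
  with False show ?thesis
    by (simp add: close_to_def algebra_simps)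
qed

lemma close_to_sup:
  fixes x y z :: "'v::{ordered_real_vector, lattice}"
  assumes "close_to e x y"
  shows "close_to e (Lattices.sup x z) (Lattices.sup y z)"
proof -
  have "Lattices.sup x z \<le> Lattices.sup y z + e" if "close_to e x y" for x y
    using close_toD(1) [OF that] close_to_nonneg [OF that]
    by (auto intro: order.trans add_mono [of z _ 0, simplified] add_right_mono)
  from this [OF assms] this [OF close_to_sym [OF assms]] show ?thesis
    by (simp add: close_to_def diff_le_eq add.commute)
qed

lemma close_to_inf:
  fixes x y z :: "'v::{ordered_real_vector, lattice}"
  assumes "close_to e x y"
  shows "close_to e (Lattices.inf x z) (Lattices.inf y z)"
proof -
  have "Lattices.inf x z - e \<le> Lattices.inf y z" if "close_to e x y" for x y
    using close_toD(1) [OF that] close_to_nonneg [OF that]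
    by (auto simp: diff_le_eq intro: le_infI1 le_infI2 add_increasing2)
  from this [OF assms] this [OF close_to_sym [OF assms]] show ?thesis
    unfolding close_to_def by (metis diff_le_eq add.commute)
qed

lemma vabs_type_vlat: "vabs type_vlat x = Lattices.sup x (- x)"
  by (simp add: vabs_def)

lemma vabs_diff_le_iff: "vabs type_vlat (vdiff type_vlat x y) \<le> e \<longleftrightarrow> close_to e x y"
  by (simp add: vabs_type_vlat vdiff_def close_to_def)

lemma vabs_nonneg: "0 \<le> vabs type_vlat (x :: 'v::{ordered_real_vector, lattice})"
  by (rule close_to_nonneg [of _ x 0]) (simp add: vabs_type_vlat close_to_def)

lemma vabs_of_nonneg:
  fixes x :: "'v::{ordered_real_vector, lattice}"
  shows "0 \<le> x \<Longrightarrow> vabs type_vlat x = x"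
  by (auto simp: vabs_type_vlat intro!: sup_absorb1 order.trans [of "- x" 0 x])

lemma ru_converges_type_vlat:
  "ru_converges type_vlat f x u \<longleftrightarrow>
    (\<forall>k>0. \<exists>N. \<forall>n\<ge>N. close_to ((1 / real k) *\<^sub>R vabs type_vlat u) (f n) x)"
  by (simp add: ru_converges_def vabs_diff_le_iff)

lemma ru_Cauchy_type_vlat:
  "ru_Cauchy type_vlat f u \<longleftrightarrow>
    (\<forall>k>0. \<exists>N. \<forall>m\<ge>N. \<forall>n\<ge>N. close_to ((1 / real k) *\<^sub>R vabs type_vlat u) (f m) (f n))"
  by (simp add: ru_Cauchy_def vabs_diff_le_iff)

text \<open>
  This is the form in which the Archimedean property passes inequalities to limits. The definition of
  \<open>archimedean\<close> is about positive elements, so it is applied to the positive parts of \<open>x\<close> and \<open>w\<close>.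
\<close>

lemma archimedean_nonpos:
  fixes x w :: "'v::{ordered_real_vector, lattice}"
  assumes arch: "archimedean (type_vlat :: 'v vlat)"
    and small: "\<And>k::nat. k > 0 \<Longrightarrow> x \<le> (1 / real k) *\<^sub>R w"
  shows "x \<le> 0"
proof -
  let ?p = "Lattices.sup x 0" and ?w = "Lattices.sup w 0"
  have "real n *\<^sub>R ?p \<le> ?w" for n :: nat
  proof (cases "n = 0")
    case False
    have "x \<le> (1 / real n) *\<^sub>R ?w"
      by (rule order.trans [OF small scaleR_left_mono]) (use False in auto)
    then have "?p \<le> (1 / real n) *\<^sub>R ?w"
      using False by (simp add: zero_le_scaleR_iff)
    then have "real n *\<^sub>R ?p \<le> real n *\<^sub>R ((1 / real n) *\<^sub>R ?w)"
      by (rule scaleR_left_mono) simp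
    then show ?thesis
      using False by simp
  qed simp
  moreover have "0 \<le> ?p"
    by simp
  ultimately have "?p = 0"
    using arch unfolding archimedean_def type_vlat_simps by blast
  then show ?thesis
    by (metis sup_ge1)
qed

lemma archimedean_close_to:
  fixes x y a w :: "'v::{ordered_real_vector, lattice}"
  assumes arch: "archimedean (type_vlat :: 'v vlat)"
    and small: "\<And>k::nat. k > 0 \<Longrightarrow> close_to (a + (1 / real k) *\<^sub>R w) x y"
  shows "close_to a x y"
proof -
  have "v - a \<le> 0" if "\<And>k::nat. k > 0 \<Longrightarrow> v \<le> a + (1 / real k) *\<^sub>R w" for v
    using that by (intro archimedean_nonpos [OF arch, of _ w]) (simp add: diff_le_eq add.commute)
  from this [of "x - y"] this [of "y - x"] small show ?thesis
    by (simp add: close_to_def)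
qed

text \<open>
  Letting the second index of the Cauchy condition tend to infinity costs an error that is a
  small multiple of the regulator of the limit, and the Archimedean property removes it. So the
  regulator of the limit, over which completeness has no control, can be replaced by the
  regulator of the Cauchy sequence.
\<close>

lemma ru_limit_regulator:
  fixes x :: "'v::{ordered_real_vector, lattice}"
  assumes arch: "archimedean (type_vlat :: 'v vlat)"
    and cauchy: "ru_Cauchy type_vlat f u"
    and conv: "ru_converges type_vlat f x w"
  shows "ru_converges type_vlat f x u"
  unfolding ru_converges_type_vlat
proof (intro allI impI)
  fix k :: nat
  assume "k > 0"
  then obtain N where N:
      "\<And>m n. m \<ge> N \<Longrightarrow> n \<ge> N \<Longrightarrow> close_to ((1 / real k) *\<^sub>R vabs type_vlat u) (f m) (f n)"
    using cauchy unfolding ru_Cauchy_type_vlat by meson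
  have "close_to ((1 / real k) *\<^sub>R vabs type_vlat u) (f n) x" if n: "n \<ge> N" for n
  proof (rule archimedean_close_to [OF arch, of _ "vabs type_vlat w"])
    fix j :: nat
    assume "j > 0"
    then obtain M where M: "\<And>m. m \<ge> M \<Longrightarrow> close_to ((1 / real j) *\<^sub>R vabs type_vlat w) (f m) x"
      using conv unfolding ru_converges_type_vlat by meson
    show "close_to ((1 / real k) *\<^sub>R vabs type_vlat u + (1 / real j) *\<^sub>R vabs type_vlat w) (f n) x"
      by (rule close_to_trans [OF N [OF n, of "max M N"] M]) auto
  qed
  then show "\<exists>N. \<forall>n\<ge>N. close_to ((1 / real k) *\<^sub>R vabs type_vlat u) (f n) x"
    by blast
qed

text \<open>
  Completeness in the form needed for extending operators: the rate of the Cauchy condition survives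
  in the limit without loss, in the same regulator.
\<close>

lemma ru_complete_rate:
  fixes f :: "nat \<Rightarrow> 'v::{ordered_real_vector, lattice}"
  assumes compl: "ru_complete (type_vlat :: 'v vlat)"
    and rate: "\<And>m n. close_to ((1 / real (Suc m) + 1 / real (Suc n)) *\<^sub>R u) (f m) (f n)"
  obtains x where "\<And>n. close_to ((1 / real (Suc n)) *\<^sub>R u) (f n) x"
proof -
  have arch: "archimedean (type_vlat :: 'v vlat)"
    using compl by (simp add: ru_complete_def)
  have "0 \<le> 2 *\<^sub>R u"
    using close_to_nonneg [OF rate [of 0 0]] by simp
  then have u: "0 \<le> u"
    by (simp add: zero_le_scaleR_iff)
  have inv_le: "1 / real (Suc m) \<le> 1 / real k" if "k > 0" "m \<ge> k" for m k :: nat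
    using that by (intro divide_left_mono) auto
  have cauchy: "ru_Cauchy type_vlat f u"
    unfolding ru_Cauchy_type_vlat
  proof (intro allI impI)
    fix k :: nat
    assume "k > 0"
    \<comment> \<open>From index \<open>2 k\<close> on, each of the two summands of the rate is at most \<open>1 / (2 k)\<close>.\<close>
    then have "close_to ((1 / real k) *\<^sub>R vabs type_vlat u) (f m) (f n)"
      if "m \<ge> 2 * k" "n \<ge> 2 * k" for m n
      using that inv_le [of "2 * k" m] inv_le [of "2 * k" n] u
      by (intro close_to_weaken [OF rate]) (auto simp: vabs_of_nonneg intro!: scaleR_right_mono)
    then show "\<exists>N. \<forall>m\<ge>N. \<forall>n\<ge>N. close_to ((1 / real k) *\<^sub>R vabs type_vlat u) (f m) (f n)"
      by blast
  qed
  then obtain x w where "ru_converges type_vlat f x w"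
    using compl unfolding ru_complete_def by auto
  then have conv: "ru_converges type_vlat f x u"
    by (rule ru_limit_regulator [OF arch cauchy])
  have "close_to ((1 / real (Suc n)) *\<^sub>R u) (f n) x" for n
  \<comment> \<open>The factor 2 collects the errors \<open>1 / (m + 1)\<close> of the rate and \<open>1 / k\<close> of the convergence at a
    large index \<open>m\<close>.\<close>
  proof (rule archimedean_close_to [OF arch, of _ "2 *\<^sub>R u"])
    fix k :: nat
    assume k: "k > 0"
    then obtain N where N: "\<And>m. m \<ge> N \<Longrightarrow> close_to ((1 / real k) *\<^sub>R u) (f m) x"
      using conv u unfolding ru_converges_type_vlat by (metis vabs_of_nonneg)
    let ?m = "max N k"
    have "close_to ((1 / real (Suc n) + 1 / real (Suc ?m)) *\<^sub>R u + (1 / real k) *\<^sub>R u) (f n) x"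
      by (rule close_to_trans [OF rate N]) simp
    then show "close_to ((1 / real (Suc n)) *\<^sub>R u + (1 / real k) *\<^sub>R 2 *\<^sub>R u) (f n) x"
    proof (rule close_to_weaken)
      have "(1 / real (Suc n) + 1 / real (Suc ?m)) *\<^sub>R u + (1 / real k) *\<^sub>R u
          = (1 / real (Suc n) + 1 / real (Suc ?m) + 1 / real k) *\<^sub>R u"
        by (simp add: scaleR_add_left)
      also have "\<dots> \<le> (1 / real (Suc n) + (1 / real k) * 2) *\<^sub>R u"
        using u inv_le [of k ?m] k by (intro scaleR_right_mono) auto
      finally show "(1 / real (Suc n) + 1 / real (Suc ?m)) *\<^sub>R u + (1 / real k) *\<^sub>R u
          \<le> (1 / real (Suc n)) *\<^sub>R u + (1 / real k) *\<^sub>R 2 *\<^sub>R u"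
        by (simp add: scaleR_add_left)
    qed
  qed
  then show thesis
    by (rule that)
qed

section \<open>The completion as a relatively uniform closure\<close>

text \<open>
  Two features make the induction rule convenient: the regulators come from the range of \<open>J\<close>, so that
  operators defined only on the domain of \<open>J\<close> can be applied to them, and the rate of convergence is fixed,
  which is no restriction up to passing to a subsequence.
\<close>

inductive_set ru_hull ::
    "('a::{ordered_real_vector, lattice} \<Rightarrow> 'f::{ordered_real_vector, lattice}) \<Rightarrow> 'f set"
  for J where
  base: "J x \<in> ru_hull J"
| limit: "(\<And>n. f n \<in> ru_hull J) \<Longrightarrow> (\<And>n. close_to ((1 / real (Suc n)) *\<^sub>R J u) (f n) x)
    \<Longrightarrow> x \<in> ru_hull J"

text \<open>
  A map \<open>h\<close> with Lipschitz constant \<open>c\<close> sends a limit with regulator \<open>J u\<close> to a limit with regulator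
  \<open>J (c u)\<close>, so it maps the hull into itself as soon as it maps the generators there.
\<close>

lemma ru_hull_Lipschitz:
  assumes J: "linear J" and y: "y \<in> ru_hull J"
    and base: "\<And>x. h (J x) \<in> ru_hull J"
    and Lip: "\<And>e x y. close_to e x y \<Longrightarrow> close_to (c *\<^sub>R e) (h x) (h y)"
  shows "h y \<in> ru_hull J"
  using y
proof induction
  case (base x)
  show ?case by (rule assms)
next
  case (limit f u x)
  have "close_to ((1 / real (Suc n)) *\<^sub>R J (c *\<^sub>R u)) (h (f n)) (h x)" for n
    using Lip [OF limit(2) [of n]] by (simp add: linear_scale [OF J] mult.commute)
  then show ?case
    using limit(3) by (rule ru_hull.limit [rotated])
qed

text \<open>
  Two nested inductions, one argument at a time: first with a generator as left argument, then with
  an arbitrary right argument from the hull.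
\<close>

lemma ru_hull_nonexpansive2:
  assumes J: "linear J" and x: "x \<in> ru_hull J" and y: "y \<in> ru_hull J"
    and base: "\<And>a b. g (J a) (J b) \<in> ru_hull J"
    and left: "\<And>e x x' y. close_to e x x' \<Longrightarrow> close_to e (g x y) (g x' y)"
    and right: "\<And>e x y y'. close_to e y y' \<Longrightarrow> close_to e (g x y) (g x y')"
  shows "g x y \<in> ru_hull J"
proof (rule ru_hull_Lipschitz [OF J x, where c = 1])
  show "g (J a) y \<in> ru_hull J" for a
    by (rule ru_hull_Lipschitz [OF J y, where c = 1]) (auto intro: base right)
qed (auto intro: left)

lemma linear_vl_hom: "vl_hom type_vlat type_vlat J \<Longrightarrow> linear J"
  by (intro linearI) (auto simp: vl_hom_def)

lemma vl_hom_sup_inf: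
  assumes "vl_hom type_vlat type_vlat J"
  shows "J (Lattices.sup x y) = Lattices.sup (J x) (J y)"
    and "J (Lattices.inf x y) = Lattices.inf (J x) (J y)"
  using assms by (auto simp: vl_hom_def join_pres_def meet_pres_def)

lemma ru_hull_closed:
  assumes J: "vl_hom type_vlat type_vlat J" and x: "x \<in> ru_hull J" and y: "y \<in> ru_hull J"
  shows ru_hull_add: "x + y \<in> ru_hull J"
    and ru_hull_scaleR: "a *\<^sub>R x \<in> ru_hull J"
    and ru_hull_sup: "Lattices.sup x y \<in> ru_hull J"
    and ru_hull_inf: "Lattices.inf x y \<in> ru_hull J"
proof -
  note lin = linear_vl_hom [OF J]
  show "x + y \<in> ru_hull J"
  proof (rule ru_hull_nonexpansive2 [OF lin x y])
    show "J a + J b \<in> ru_hull J" for a b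
      using ru_hull.base [of J "a + b"] by (simp add: linear_add [OF lin])
  qed (auto simp: close_to_def)
  show "a *\<^sub>R x \<in> ru_hull J"
  proof (rule ru_hull_Lipschitz [OF lin x])
    show "a *\<^sub>R J b \<in> ru_hull J" for b
      using ru_hull.base [of J "a *\<^sub>R b"] by (simp add: linear_scale [OF lin])
  qed (rule close_to_scale)
  show "Lattices.sup x y \<in> ru_hull J"
  proof (rule ru_hull_nonexpansive2 [OF lin x y])
    show "Lattices.sup (J a) (J b) \<in> ru_hull J" for a b
      using ru_hull.base [of J "Lattices.sup a b"] by (simp add: vl_hom_sup_inf [OF J])
  qed (metis close_to_sup sup_commute)+
  show "Lattices.inf x y \<in> ru_hull J"
  proof (rule ru_hull_nonexpansive2 [OF lin x y])
    show "Lattices.inf (J a) (J b) \<in> ru_hull J" for a b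
      using ru_hull.base [of J "Lattices.inf a b"] by (simp add: vl_hom_sup_inf [OF J])
  qed (metis close_to_inf inf_commute)+
qed

text \<open>
  A limit with regulator \<open>J u\<close> lies below the first term of the sequence plus \<open>J u\<close>.
\<close>

lemma ru_hull_majorized:
  assumes J: "vl_hom type_vlat type_vlat J" and "x \<in> ru_hull J"
  shows "\<exists>b. x \<le> J b"
  using assms(2)
proof induction
  case (limit f u x)
  then obtain b where "f 0 \<le> J b"
    by blast
  then have "x \<le> J b + J u"
    using close_toD(2) [OF limit(2) [of 0]] by (auto intro: order.trans add_right_mono)
  then show ?case
    by (metis linear_add [OF linear_vl_hom [OF J]])
qed auto

text \<open>
  The hull has to serve as a test lattice in the universal property, hence as a structure on a carrier
  set.
\<close>

definition sub_vlat :: "'v::{ordered_real_vector, lattice} set \<Rightarrow> 'v vlat"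
  where "sub_vlat C = type_vlat\<lparr>carrier := C\<rparr>"

lemma sub_vlat_simps [simp]:
  "carrier (sub_vlat C) = C"
  "x .=\<^bsub>sub_vlat C\<^esub> y \<longleftrightarrow> x = y"
  "x \<sqsubseteq>\<^bsub>sub_vlat C\<^esub> y \<longleftrightarrow> x \<le> y"
  "vadd (sub_vlat C) = (+)"
  "vzero (sub_vlat C) = 0"
  "vscale (sub_vlat C) = (*\<^sub>R)"
  by (simp_all add: sub_vlat_def type_vlat_def)

locale vector_sublattice =
  fixes C :: "'v::{ordered_real_vector, lattice} set"
  assumes zero: "0 \<in> C"
    and add: "x \<in> C \<Longrightarrow> y \<in> C \<Longrightarrow> x + y \<in> C"
    and scale: "x \<in> C \<Longrightarrow> a *\<^sub>R x \<in> C"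
    and sup: "x \<in> C \<Longrightarrow> y \<in> C \<Longrightarrow> Lattices.sup x y \<in> C"
    and inf: "x \<in> C \<Longrightarrow> y \<in> C \<Longrightarrow> Lattices.inf x y \<in> C"
begin

lemma least_Upper_sub_vlat:
  "x \<in> C \<Longrightarrow> y \<in> C \<Longrightarrow> least (sub_vlat C) s (Upper (sub_vlat C) {x, y}) \<longleftrightarrow> s = Lattices.sup x y"
  using sup by (auto simp: least_def Upper_def intro: order.antisym)

lemma greatest_Lower_sub_vlat:
  "x \<in> C \<Longrightarrow> y \<in> C \<Longrightarrow> greatest (sub_vlat C) s (Lower (sub_vlat C) {x, y}) \<longleftrightarrow> s = Lattices.inf x y"
  using inf by (auto simp: greatest_def Lower_def intro: order.antisym)

lemma join_sub_vlat: "x \<in> C \<Longrightarrow> y \<in> C \<Longrightarrow> x \<squnion>\<^bsub>sub_vlat C\<^esub> y = Lattices.sup x y"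
  by (simp add: join_def Lattice.sup_def least_Upper_sub_vlat)

lemma meet_sub_vlat: "x \<in> C \<Longrightarrow> y \<in> C \<Longrightarrow> x \<sqinter>\<^bsub>sub_vlat C\<^esub> y = Lattices.inf x y"
  by (simp add: meet_def Lattice.inf_def greatest_Lower_sub_vlat)

lemma vector_lattice_sub_vlat: "vector_lattice (sub_vlat C)"
proof -
  have "\<exists>y\<in>C. y + x = 0" if "x \<in> C" for x
    using scale [OF that, of "- 1"] by (intro bexI [of _ "- x"]) auto
  then have "comm_group \<lparr>carrier = C, mult = (+), one = 0\<rparr>"
    by (intro comm_groupI) (auto simp: add.assoc add.commute intro: zero add)
  moreover have "Lattice.lattice (sub_vlat C)"
    by unfold_locales (auto simp: fun_eq_iff least_Upper_sub_vlat greatest_Lower_sub_vlat)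
  ultimately show ?thesis
    by (intro vector_lattice.intro vector_lattice_axioms.intro)
      (auto simp: scaleR_add_right scaleR_add_left intro: scaleR_left_mono scale)
qed

lemma vabs_sub_vlat: "x \<in> C \<Longrightarrow> vabs (sub_vlat C) x = vabs type_vlat x"
  using scale [of x "- 1"] by (simp add: vabs_def join_sub_vlat)

lemma vdiff_sub_vlat: "vdiff (sub_vlat C) x y = vdiff type_vlat x y"
  by (simp add: vdiff_def)

lemma vdiff_closed: "x \<in> C \<Longrightarrow> y \<in> C \<Longrightarrow> vdiff type_vlat x y \<in> C"
  unfolding vdiff_def type_vlat_simps by (intro add scale)

lemma ru_Cauchy_sub_vlat:
  "(\<And>n. f n \<in> C) \<Longrightarrow> u \<in> C \<Longrightarrow> ru_Cauchy (sub_vlat C) f u \<longleftrightarrow> ru_Cauchy type_vlat f u"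
  by (simp add: ru_Cauchy_def vdiff_sub_vlat vabs_sub_vlat vdiff_closed)

lemma ru_converges_sub_vlat:
  "(\<And>n. f n \<in> C) \<Longrightarrow> x \<in> C \<Longrightarrow> u \<in> C \<Longrightarrow>
    ru_converges (sub_vlat C) f x u \<longleftrightarrow> ru_converges type_vlat f x u"
  by (simp add: ru_converges_def vdiff_sub_vlat vabs_sub_vlat vdiff_closed)

lemma archimedean_sub_vlat: "archimedean (type_vlat :: 'v vlat) \<Longrightarrow> archimedean (sub_vlat C)"
  by (auto simp: archimedean_def)

lemma vl_hom_sub_vlat:
  fixes S :: "'w::{ordered_real_vector, lattice} \<Rightarrow> 'v"
  shows "vl_hom type_vlat (sub_vlat C) S \<longleftrightarrow> vl_hom type_vlat type_vlat S \<and> range S \<subseteq> C"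
proof -
  have "Lattice.lattice (sub_vlat C)" "Lattice.lattice (type_vlat :: 'w vlat)"
    "Lattice.lattice (type_vlat :: 'v vlat)"
    by (rule vector_lattice.axioms, rule vector_lattice_sub_vlat vector_lattice_type_vlat)+
  then show ?thesis
    by (auto simp: vl_hom_def join_pres_def meet_pres_def join_sub_vlat meet_sub_vlat
        Pi_iff image_subset_iff)
qed

end

lemma vector_sublattice_ru_hull:
  assumes "vl_hom type_vlat type_vlat J"
  shows "vector_sublattice (ru_hull J)"
  by unfold_locales
    (auto intro: ru_hull_closed [OF assms]
       simp: ru_hull.base [of J 0, unfolded linear_0 [OF linear_vl_hom [OF assms]]])

text \<open>
  A Cauchy sequence of the hull has a limit \<open>x\<close> in the whole lattice, with a regulator about which
  nothing is known. Its own regulator \<open>u\<close> works as well by \<open>ru_limit_regulator\<close>, and \<open>\<bar>u\<bar>\<close> is dominated by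
  some \<open>J v\<close>. A subsequence with the right rate then shows that \<open>x\<close> belongs to the hull.
\<close>

lemma ru_complete_ru_hull:
  fixes J :: "'a::{ordered_real_vector, lattice} \<Rightarrow> 'f::{ordered_real_vector, lattice}"
  assumes J: "vl_hom type_vlat type_vlat J"
    and compl: "ru_complete (type_vlat :: 'f vlat)"
  shows "ru_complete (sub_vlat (ru_hull J))"
proof -
  interpret vector_sublattice "ru_hull J"
    by (rule vector_sublattice_ru_hull [OF J])
  have arch: "archimedean (type_vlat :: 'f vlat)"
    using compl by (simp add: ru_complete_def)
  have "\<exists>x\<in>ru_hull J. \<exists>w\<in>ru_hull J. ru_converges (sub_vlat (ru_hull J)) f x w"
    if f: "\<And>n. f n \<in> ru_hull J" and u: "u \<in> ru_hull J"
      and "ru_Cauchy (sub_vlat (ru_hull J)) f u" for f u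
  proof -
    have cauchy: "ru_Cauchy type_vlat f u"
      using that by (simp add: ru_Cauchy_sub_vlat)
    then obtain x w where "ru_converges type_vlat f x w"
      using compl unfolding ru_complete_def by auto
    then have conv: "ru_converges type_vlat f x u"
      by (rule ru_limit_regulator [OF arch cauchy])
    have "vabs type_vlat u \<in> ru_hull J"
      using sup [OF u scale [OF u, of "- 1"]] by (simp add: vabs_type_vlat)
    then obtain v where v: "vabs type_vlat u \<le> J v"
      using ru_hull_majorized [OF J] by blast
    have "\<exists>m. close_to ((1 / real (Suc n)) *\<^sub>R vabs type_vlat u) (f m) x" for n
      using conv unfolding ru_converges_type_vlat by (metis order_refl zero_less_Suc)
    then obtain \<phi> where \<phi>:
        "\<And>n. close_to ((1 / real (Suc n)) *\<^sub>R vabs type_vlat u) (f (\<phi> n)) x"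
      by metis
    have "close_to ((1 / real (Suc n)) *\<^sub>R J v) (f (\<phi> n)) x" for n
      by (rule close_to_weaken [OF \<phi>]) (rule scaleR_left_mono [OF v], simp)
    then have "x \<in> ru_hull J"
      by (rule ru_hull.limit [rotated]) (rule f)
    with f u conv show ?thesis
      by (auto simp: ru_converges_sub_vlat)
  qed
  then show ?thesis
    by (auto simp: ru_complete_def intro: archimedean_sub_vlat [OF arch])
qed

text \<open>
  The universal property is used for two test lattices. With the hull it yields a lattice homomorphism
  \<open>S\<close> into the hull that fixes the range of \<open>J\<close>; uniqueness for the whole lattice then identifies \<open>S\<close>
  with the identity.
\<close>

lemma ru_hull_eq_UNIV:
  fixes J :: "'a::{ordered_real_vector, lattice} \<Rightarrow> 'f::{ordered_real_vector, lattice}"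
  assumes "ru_completion J"
  shows "ru_hull J = UNIV"
proof -
  have compl: "ru_complete (type_vlat :: 'f vlat)" and J: "vl_hom type_vlat type_vlat J"
    and univ: "\<And>(Y :: 'f vlat) T. vector_lattice Y \<Longrightarrow> ru_complete Y \<Longrightarrow> vl_hom type_vlat Y T
      \<Longrightarrow> \<exists>!S. vl_hom type_vlat Y S \<and> S \<circ> J = T"
    using assms by (auto simp: ru_completion_def)
  interpret vector_sublattice "ru_hull J"
    by (rule vector_sublattice_ru_hull [OF J])
  have "vl_hom type_vlat (sub_vlat (ru_hull J)) J"
    using J by (auto simp: vl_hom_sub_vlat intro: ru_hull.base)
  then obtain S where "vl_hom type_vlat (sub_vlat (ru_hull J)) S" and SJ: "S \<circ> J = J"
    using univ [OF vector_lattice_sub_vlat ru_complete_ru_hull [OF J compl]] by blast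
  then have S: "vl_hom type_vlat type_vlat S" and range: "range S \<subseteq> ru_hull J"
    by (simp_all add: vl_hom_sub_vlat)
  have "vl_hom type_vlat type_vlat (id :: 'f \<Rightarrow> 'f)"
    using J by (auto simp: vl_hom_def join_pres_def meet_pres_def)
  then have "S = id"
    using univ [OF vector_lattice_type_vlat compl J] S SJ by auto
  then show ?thesis
    using range by auto
qed

section \<open>Extension of a positive operator\<close>

text \<open>
  \<open>z\<close> is the infimum of all \<open>P x\<close> with \<open>y \<le> J x\<close>. The infimum is described by its lower bounds, since it
  need not exist in a lattice that is not Dedekind complete.
\<close>

definition upper_value :: "('a \<Rightarrow> 'f::order) \<Rightarrow> ('a \<Rightarrow> 'g::order) \<Rightarrow> 'f \<Rightarrow> 'g \<Rightarrow> bool"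
  where "upper_value J P y z \<longleftrightarrow> (\<forall>l. l \<le> z \<longleftrightarrow> (\<forall>x. y \<le> J x \<longrightarrow> l \<le> P x))"

lemma upper_value_le: "upper_value J P y z \<Longrightarrow> y \<le> J x \<Longrightarrow> z \<le> P x"
  by (auto simp: upper_value_def)

lemma upper_value_greatest:
  "upper_value J P y z \<Longrightarrow> (\<And>x. y \<le> J x \<Longrightarrow> l \<le> P x) \<Longrightarrow> l \<le> z"
  by (auto simp: upper_value_def)

lemma upper_value_unique: "upper_value J P y z \<Longrightarrow> upper_value J P y z' \<Longrightarrow> z = z'"
  by (meson order.antisym upper_value_le upper_value_greatest)

lemma upper_value_base:
  assumes "\<And>x y. J x \<le> J y \<Longrightarrow> P x \<le> P y"
  shows "upper_value J P (J x) (P x)"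
  using assms unfolding upper_value_def by (meson order.refl order.trans)

text \<open>
  Sums of majorants majorize the sum. Since the two infima range over independent majorants, they are
  taken one after the other.
\<close>

lemma upper_value_add_le:
  fixes z :: "'g::ordered_real_vector"
  assumes J: "linear J" and P: "linear P"
    and y1: "upper_value J P y1 z1" and y2: "upper_value J P y2 z2"
    and y: "upper_value J P (y1 + y2 :: 'f::ordered_real_vector) z"
  shows "z \<le> z1 + z2"
proof -
  have "z - P x1 \<le> z2" if x1: "y1 \<le> J x1" for x1
  proof (rule upper_value_greatest [OF y2])
    fix x2
    assume "y2 \<le> J x2"
    then have "y1 + y2 \<le> J (x1 + x2)"
      using x1 by (simp add: linear_add [OF J] add_mono)
    then show "z - P x1 \<le> P x2"
      using upper_value_le [OF y, of "x1 + x2"] by (simp add: linear_add [OF P] diff_le_eq add.commute)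
  qed
  then have "z - z2 \<le> z1"
    by (intro upper_value_greatest [OF y1]) (auto simp: algebra_simps)
  then show ?thesis
    by (simp add: diff_le_eq)
qed

lemma upper_value_scale:
  fixes y :: "'f::ordered_real_vector" and z :: "'g::ordered_real_vector"
  assumes J: "linear J" and P: "linear P" and y: "upper_value J P y z" and c: "c > 0"
  shows "upper_value J P (c *\<^sub>R y) (c *\<^sub>R z)"
  unfolding upper_value_def
proof (intro allI iffI impI)
  fix l x
  assume l: "l \<le> c *\<^sub>R z" and x: "c *\<^sub>R y \<le> J x"
  have "y \<le> J (x /\<^sub>R c)"
    using x c by (simp add: linear_scale [OF J] pos_le_divideR_eq)
  then have "z \<le> P (x /\<^sub>R c)"
    by (rule upper_value_le [OF y])
  then have "c *\<^sub>R z \<le> P x"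
    using c by (simp add: linear_scale [OF P] pos_le_divideR_eq)
  with l show "l \<le> P x"
    by (rule order.trans)
next
  fix l
  assume l: "\<forall>x. c *\<^sub>R y \<le> J x \<longrightarrow> l \<le> P x"
  have "l /\<^sub>R c \<le> z"
  proof (rule upper_value_greatest [OF y])
    fix x
    assume "y \<le> J x"
    then have "c *\<^sub>R y \<le> J (c *\<^sub>R x)"
      using c by (simp add: linear_scale [OF J] scaleR_left_mono)
    then show "l /\<^sub>R c \<le> P x"
      using l c by (auto simp: linear_scale [OF P] pos_divideR_le_eq)
  qed
  then show "l \<le> c *\<^sub>R z"
    using c by (simp add: pos_divideR_le_eq)
qed

text \<open>
  The infimum inherits one-sided Lipschitz bounds: if \<open>J x\<close> majorizes \<open>y\<close>, then \<open>J (x + c u)\<close>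
  majorizes \<open>y'\<close>. This is what makes the values along a convergent sequence a Cauchy sequence.
\<close>

lemma upper_value_shift:
  fixes y :: "'f::ordered_real_vector" and z :: "'g::ordered_real_vector"
  assumes J: "linear J" and P: "linear P"
    and y: "upper_value J P y z" and y': "upper_value J P y' z'"
    and le: "y' - y \<le> c *\<^sub>R J u"
  shows "z' - z \<le> c *\<^sub>R P u"
proof -
  have "z' - c *\<^sub>R P u \<le> P x" if "y \<le> J x" for x
  proof -
    have "y' \<le> J (x + c *\<^sub>R u)"
      using add_mono [OF that le] by (simp add: linear_add [OF J] linear_scale [OF J])
    then show ?thesis
      using upper_value_le [OF y', of "x + c *\<^sub>R u"]
      by (simp add: linear_add [OF P] linear_scale [OF P] diff_le_eq)
  qed
  then have "z' - c *\<^sub>R P u \<le> z"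
    by (rule upper_value_greatest [OF y])
  then show ?thesis
    by (simp add: algebra_simps)
qed

text \<open>
  Majorants of \<open>y\<close> and of \<open>f n\<close> differ by small multiples of \<open>u\<close>, and \<open>z\<close> differs from \<open>g n\<close> by small
  multiples of \<open>P u\<close>. Both halves of the infimum property thus hold up to a small multiple of
  \<open>2 P u\<close>, one \<open>P u\<close> for each of these two errors.
\<close>

lemma upper_value_limit:
  fixes y :: "'f::ordered_real_vector" and z :: "'g::{ordered_real_vector, lattice}"
  assumes arch: "archimedean (type_vlat :: 'g vlat)"
    and J: "linear J" and P: "linear P"
    and f: "\<And>n. upper_value J P (f n) (g n)"
    and y: "\<And>n. close_to ((1 / real (Suc n)) *\<^sub>R J u) (f n) y"
    and z: "\<And>n. close_to ((1 / real (Suc n)) *\<^sub>R P u) (g n) z"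
  shows "upper_value J P y z"
  unfolding upper_value_def
proof (intro allI iffI impI)
  fix l x
  assume l: "l \<le> z" and x: "y \<le> J x"
  have "z - P x \<le> 0"
  proof (rule archimedean_nonpos [OF arch, of _ "2 *\<^sub>R P u"])
    fix k :: nat
    assume "k > 0"
    then obtain n where k: "k = Suc n"
      using gr0_implies_Suc by blast
    have "f n \<le> J (x + (1 / real k) *\<^sub>R u)"
      using order.trans [OF close_toD(1) [OF y [of n]] add_right_mono [OF x]]
      by (simp add: k linear_add [OF J] linear_scale [OF J])
    then have "g n \<le> P x + (1 / real k) *\<^sub>R P u"
      using upper_value_le [OF f] by (metis linear_add [OF P] linear_scale [OF P])
    then have "z \<le> P x + (1 / real k) *\<^sub>R P u + (1 / real k) *\<^sub>R P u"
      using close_toD(2) [OF z [of n]] k by (metis order.trans add_right_mono)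
    then show "z - P x \<le> (1 / real k) *\<^sub>R 2 *\<^sub>R P u"
      unfolding scaleR_2 scaleR_add_right by (simp add: algebra_simps)
  qed
  with l show "l \<le> P x"
    by (simp add: order.trans)
next
  fix l
  assume l: "\<forall>x. y \<le> J x \<longrightarrow> l \<le> P x"
  have "l - z \<le> 0"
  proof (rule archimedean_nonpos [OF arch, of _ "2 *\<^sub>R P u"])
    fix k :: nat
    assume "k > 0"
    then obtain n where k: "k = Suc n"
      using gr0_implies_Suc by blast
    have "l - (1 / real k) *\<^sub>R P u \<le> g n"
    proof (rule upper_value_greatest [OF f])
      fix x
      assume "f n \<le> J x"
      then have "y \<le> J (x + (1 / real k) *\<^sub>R u)"
        using order.trans [OF close_toD(2) [OF y [of n]] add_right_mono]
        by (simp add: k linear_add [OF J] linear_scale [OF J])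
      then show "l - (1 / real k) *\<^sub>R P u \<le> P x"
        using l by (metis linear_add [OF P] linear_scale [OF P] diff_le_eq)
    qed
    also have "g n \<le> z + (1 / real k) *\<^sub>R P u"
      using close_toD(1) [OF z [of n]] k by simp
    finally have "l \<le> z + (1 / real k) *\<^sub>R P u + (1 / real k) *\<^sub>R P u"
      by (simp add: diff_le_eq)
    then show "l - z \<le> (1 / real k) *\<^sub>R 2 *\<^sub>R P u"
      unfolding scaleR_2 scaleR_add_right by (simp add: algebra_simps)
  qed
  then show "l \<le> z"
    by simp
qed

text \<open>
  The second conjunct says that \<open>z\<close> is the supremum of all \<open>P x\<close> with \<open>J x \<le> y\<close> when \<open>J\<close> and \<open>P\<close> are
  linear. Writing it as an infimum at \<open>- y\<close> lets each fact about infima serve both sides.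
\<close>

definition squeezed_value ::
    "('a \<Rightarrow> 'f::ordered_ab_group_add) \<Rightarrow> ('a \<Rightarrow> 'g::ordered_ab_group_add) \<Rightarrow> 'f \<Rightarrow> 'g \<Rightarrow> bool"
  where "squeezed_value J P y z \<longleftrightarrow> upper_value J P y z \<and> upper_value J P (- y) (- z)"

lemma squeezed_value_exists_on_hull:
  fixes J :: "'a::{ordered_real_vector, lattice} \<Rightarrow> 'f::{ordered_real_vector, lattice}"
    and P :: "'a \<Rightarrow> 'g::{ordered_real_vector, lattice}"
  assumes compl: "ru_complete (type_vlat :: 'g vlat)"
    and J: "linear J" and P: "linear P"
    and mono: "\<And>x y. J x \<le> J y \<Longrightarrow> P x \<le> P y"
    and y: "y \<in> ru_hull J"
  shows "\<exists>z. squeezed_value J P y z"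
  using y
proof induction
  case (base x)
  have "squeezed_value J P (J x) (P x)"
    using upper_value_base [of J P x, OF mono] upper_value_base [of J P "- x", OF mono]
    by (simp add: squeezed_value_def linear_neg [OF J] linear_neg [OF P])
  then show ?case ..
next
  case (limit f u x)
  have arch: "archimedean (type_vlat :: 'g vlat)"
    using compl by (simp add: ru_complete_def)
  obtain g where g: "\<And>n. squeezed_value J P (f n) (g n)"
    using limit(3) by metis
  have "close_to ((1 / real (Suc m) + 1 / real (Suc n)) *\<^sub>R P u) (g m) (g n)" for m n
  proof -
    have "close_to ((1 / real (Suc m) + 1 / real (Suc n)) *\<^sub>R J u) (f m) (f n)"
      using close_to_trans [OF limit(2) [of m] close_to_sym [OF limit(2) [of n]]]
      by (simp add: scaleR_add_left)
    then show ?thesis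
      using g by (auto simp: close_to_def squeezed_value_def intro: upper_value_shift [OF J P])
  qed
  then obtain z where z: "\<And>n. close_to ((1 / real (Suc n)) *\<^sub>R P u) (g n) z"
    by (rule ru_complete_rate [OF compl]) blast
  have "squeezed_value J P x z"
    unfolding squeezed_value_def
  proof
    show "upper_value J P x z"
      by (rule upper_value_limit [OF arch J P _ limit(2) z]) (use g in \<open>simp add: squeezed_value_def\<close>)
    show "upper_value J P (- x) (- z)"
      by (rule upper_value_limit [OF arch J P _ close_to_minus [OF limit(2)] close_to_minus [OF z]])
        (use g in \<open>simp add: squeezed_value_def\<close>)
  qed
  then show ?case ..
qed

lemma squeezed_value_add:
  fixes y1 :: "'f::ordered_real_vector" and z1 :: "'g::ordered_real_vector"
  assumes J: "linear J" and P: "linear P"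
    and "squeezed_value J P y1 z1" and "squeezed_value J P y2 z2"
    and "squeezed_value J P (y1 + y2) z"
  shows "z = z1 + z2"
proof (rule order.antisym)
  show "z \<le> z1 + z2"
    using assms(3-5) by (auto simp: squeezed_value_def intro: upper_value_add_le [OF J P])
  have "- z \<le> - z1 + - z2"
    using assms(3-5)
    by (intro upper_value_add_le [OF J P, of "- y1" _ "- y2"]) (auto simp: squeezed_value_def)
  then show "z1 + z2 \<le> z"
    by (metis minus_add_distrib neg_le_iff_le)
qed

lemma squeezed_value_scale:
  fixes y :: "'f::ordered_real_vector" and z :: "'g::ordered_real_vector"
  assumes J: "linear J" and P: "linear P" and mono: "\<And>x y. J x \<le> J y \<Longrightarrow> P x \<le> P y"
    and y: "squeezed_value J P y z"
  shows "squeezed_value J P (c *\<^sub>R y) (c *\<^sub>R z)"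
proof -
  consider "c > 0" | "c = 0" | "- c > 0"
    by linarith
  then show ?thesis
  proof cases
    case 1
    then show ?thesis
      using y upper_value_scale [OF J P, of y z c] upper_value_scale [OF J P, of "- y" "- z" c]
      by (simp add: squeezed_value_def)
  next
    case 2
    then show ?thesis
      using upper_value_base [of J P 0, OF mono]
      by (simp add: squeezed_value_def linear_0 [OF J] linear_0 [OF P])
  next
    case 3
    then show ?thesis
      using y upper_value_scale [OF J P, of y z "- c"] upper_value_scale [OF J P, of "- y" "- z" "- c"]
      by (simp add: squeezed_value_def)
  qed
qed

lemma vl_embedding_le_iff:
  assumes J: "vl_hom type_vlat type_vlat J" and inj: "inj J"
  shows "J x \<le> J y \<longleftrightarrow> x \<le> y"
proof -
  have "J x \<le> J y \<longleftrightarrow> J (Lattices.inf x y) = J x"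
    by (simp add: vl_hom_sup_inf [OF J] le_iff_inf)
  also have "\<dots> \<longleftrightarrow> x \<le> y"
    by (simp add: inj_eq [OF inj] le_iff_inf)
  finally show ?thesis .
qed

text \<open>
  The unique squeezed value at each point defines \<open>S\<close>. Another positive extension lies below \<open>S\<close>, because
  \<open>S y\<close> is the infimum of upper bounds for it; at \<open>- y\<close> this gives the reverse inequality.
\<close>

theorem positive_extension:
  fixes J :: "'a::{ordered_real_vector, lattice} \<Rightarrow> 'f::{ordered_real_vector, lattice}"
    and P :: "'a \<Rightarrow> 'g::{ordered_real_vector, lattice}"
  assumes J: "ru_completion J" and compl: "ru_complete (type_vlat :: 'g vlat)"
    and P: "linear P" and pos: "\<And>x. 0 \<le> x \<Longrightarrow> 0 \<le> P x"
  shows "\<exists>!S :: 'f \<Rightarrow> 'g. linear S \<and> (\<forall>y\<ge>0. 0 \<le> S y) \<and> S \<circ> J = P"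
proof -
  have hom: "vl_hom type_vlat type_vlat J" and inj: "inj J"
    using J by (auto simp: ru_completion_def)
  have lin: "linear J"
    by (rule linear_vl_hom [OF hom])
  have mono: "P x \<le> P y" if "J x \<le> J y" for x y
    using pos [of "y - x"] that by (simp add: vl_embedding_le_iff [OF hom inj] linear_diff [OF P])
  have base: "upper_value J P (J x) (P x)" for x
    by (rule upper_value_base [of J P, OF mono])
  obtain S where S: "\<And>y. squeezed_value J P y (S y)"
    using squeezed_value_exists_on_hull [OF compl lin P mono] ru_hull_eq_UNIV [OF J]
    by (metis UNIV_I)
  have S_upper: "upper_value J P y (S y)" for y
    using S by (simp add: squeezed_value_def)
  have "linear S"
  proof (rule linearI)
    show "S (y1 + y2) = S y1 + S y2" for y1 y2
      by (rule squeezed_value_add [OF lin P S S S])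
    show "S (c *\<^sub>R y) = c *\<^sub>R S y" for c y
      using squeezed_value_scale [OF lin P mono S] S_upper
      by (auto simp: squeezed_value_def intro: upper_value_unique)
  qed
  moreover have "0 \<le> S y" if "0 \<le> y" for y
  proof (rule upper_value_greatest [OF S_upper])
    fix x
    assume "y \<le> J x"
    with that have "J 0 \<le> J x"
      by (simp add: linear_0 [OF lin])
    then show "0 \<le> P x"
      using mono by (metis linear_0 [OF P])
  qed
  moreover have "S \<circ> J = P"
    by (auto simp: fun_eq_iff intro: upper_value_unique [OF S_upper base])
  moreover have "S' = S" if S': "linear S'" "\<forall>y\<ge>0. 0 \<le> S' y" "S' \<circ> J = P" for S'
  proof
    fix y
    have le: "S' y \<le> S y" for y
    proof (rule upper_value_greatest [OF S_upper])
      fix x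
      assume "y \<le> J x"
      then have "0 \<le> S' (J x - y)"
        using S'(2) by simp
      then show "S' y \<le> P x"
        using S'(3) by (auto simp: linear_diff [OF S'(1)])
    qed
    have "- S' y \<le> - S y"
      using le [of "- y"] by (simp add: linear_neg [OF S'(1)] linear_neg [OF \<open>linear S\<close>])
    with le show "S' y = S y"
      by (simp add: order.antisym)
  qed
  ultimately show ?thesis
    by blast
qed

section \<open>Extension of a positive semigroup\<close>

theorem theorem2:
  fixes J :: "'a::{ordered_real_vector, lattice} \<Rightarrow> 'f::{ordered_real_vector, lattice}"
    and T :: "real \<Rightarrow> 'a \<Rightarrow> 'a"
  assumes "archimedean (type_vlat :: 'a vlat)"
    and "ru_completion J"
    and "positive_semigroup T"
  shows "\<exists>!Tr :: real \<Rightarrow> 'f \<Rightarrow> 'f. Tr \<in> extensional {0..} \<and> positive_semigroup Tr \<and>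
           (\<forall>s\<ge>0. \<forall>x. Tr s (J x) = J (T s x))"
proof -
  have compl: "ru_complete (type_vlat :: 'f vlat)" and hom: "vl_hom type_vlat type_vlat J"
    and inj: "inj J"
    using assms(2) by (auto simp: ru_completion_def)
  have lin: "linear J"
    by (rule linear_vl_hom [OF hom])
  have T: "linear (T s)" "0 \<le> x \<Longrightarrow> 0 \<le> T s x" if "s \<ge> 0" for s x
    using assms(3) that by (auto simp: positive_semigroup_def positive_operator_def)
  have T0: "T 0 = id" and T_add: "\<And>s t. s \<ge> 0 \<Longrightarrow> t \<ge> 0 \<Longrightarrow> T (s + t) = T s \<circ> T t"
    using assms(3) by (auto simp: positive_semigroup_def)
  have ext: "\<exists>!S :: 'f \<Rightarrow> 'f. positive_operator S \<and> (\<forall>x. S (J x) = J (T s x))" if "s \<ge> 0" for s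
  proof -
    have "0 \<le> J x" if "0 \<le> x" for x
      using that vl_embedding_le_iff [OF hom inj, of 0 x] by (simp add: linear_0 [OF lin])
    then have "\<exists>!S :: 'f \<Rightarrow> 'f. linear S \<and> (\<forall>y\<ge>0. 0 \<le> S y) \<and> S \<circ> J = J \<circ> T s"
      using T [OF that] lin
      by (intro positive_extension [OF assms(2) compl]) (auto intro: linear_compose)
    then show ?thesis
      by (simp add: positive_operator_def fun_eq_iff conj_assoc)
  qed
  \<comment> \<open>The restriction to nonnegative times makes the family unique as a function on all reals.\<close>
  define Tr where "Tr = restrict (\<lambda>s. THE S :: 'f \<Rightarrow> 'f.
      positive_operator S \<and> (\<forall>x. S (J x) = J (T s x))) {0..}"
  have Tr: "positive_operator (Tr s) \<and> (\<forall>x. Tr s (J x) = J (T s x))" if "s \<ge> 0" for s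
    using theI' [OF ext [OF that]] that by (simp add: Tr_def)
  have unique: "S = S'"
    if "s \<ge> 0" "positive_operator S" "\<And>x. S (J x) = J (T s x)"
      "positive_operator S'" "\<And>x. S' (J x) = J (T s x)"
    for s and S S' :: "'f \<Rightarrow> 'f"
    using ext [OF that(1)] that(2-) by blast
  have "positive_semigroup Tr"
    unfolding positive_semigroup_def
  proof (intro conjI allI impI)
    show "positive_operator (Tr s)" if "0 \<le> s" for s
      using Tr [OF that] by blast
    show "Tr 0 = id"
      by (rule unique [of 0])
        (use Tr [of 0] T0 in \<open>auto simp: positive_operator_def linear_id\<close>)
    fix s t :: real
    assume st: "0 \<le> s" "0 \<le> t"
    show "Tr (s + t) = Tr s \<circ> Tr t"
    proof (rule unique [of "s + t"])
      show "positive_operator (Tr s \<circ> Tr t)"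
        using Tr [OF st(1)] Tr [OF st(2)] by (auto simp: positive_operator_def intro: linear_compose)
    qed (use st Tr in \<open>simp_all add: T_add\<close>)
  qed
  moreover have "Tr \<in> extensional {0..}"
    by (simp add: Tr_def)
  moreover have "R = Tr"
    if R: "R \<in> extensional {0..}" "positive_semigroup R" "\<forall>s\<ge>0. \<forall>x. R s (J x) = J (T s x)" for R
  proof (rule extensionalityI [OF R(1) \<open>Tr \<in> extensional {0..}\<close>])
    show "R s = Tr s" if "s \<in> {0..}" for s
      using that R Tr by (intro unique [of s]) (auto simp: positive_semigroup_def)
  qed
  moreover have "\<forall>s\<ge>0. \<forall>x. Tr s (J x) = J (T s x)"
    using Tr by simp
  ultimately show ?thesis
    by (intro ex1I [of _ Tr]) blast+
qed

end
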